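(* Define integral domains $R_n$ ($n\ge 0$) recursively. Let $Y_n=\{y_n^{q}: q\in\mathbb{Q},\ q>0\}$ for each $n\ge 0$, and let $R_0=\mathbb{F}_2[Y_0]$. Given $R_n$, let $\Gamma_n=\{\alpha\in R_n : \alpha \text{ is not atomic in } R_n\}$ and let $$R_{n+1}=R_n[z_\gamma]\left[\frac{x_{n+1}\gamma}{z_\gamma}\right]_{\gamma\in\Gamma_n}[Y_{n+1}],$$ where $x_{n+1}$, $y_{n+1}$ and the $z_\gamma$ ($\gamma\in\Gamma_n$) are indeterminates. Let $D=\bigcup_{n=0}^\infty R_n$. Then $D$ is almost atomic, but not semi-Furstenberg.
   Context: For a domain $A$, $A[Y_n]$ denotes the ring of polynomials over $A$ in $y_n$ with nonnegative rational exponents. The ring $R_n[z_\gamma][x_{n+1}\gamma/z_\gamma]_{\gamma\in\Gamma_n}$ is the subring generated over $R_n$ by all the elements $z_\gamma$ and $x_{n+1}\gamma/z_\gamma$ ($\gamma\in\Gamma_n$) inside the fraction field of the polynomial ring over $R_n$ in the independent indeterminates $x_{n+1}$ and $z_\gamma$ ($\gamma\in\Gamma_n$); the $z_\gamma$ adjoined at each stage are new. An element of a domain is atomic if it is a product of one or more irreducible elements of that domain. An integral domain $D$ is almost atomic if for every nonzero non-unit $\alpha\in D$ there exist irreducible elements $\pi_1,\dots,\pi_n\in D$ such that $\alpha\pi_1\cdots\pi_n$ is a product of irreducible elements. An integral domain $D$ is semi-Furstenberg if there exists $\beta\in D$ such that for every nonzero non-unit $\alpha\in D$ there is an irreducible $\pi\in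 D$ such that $\pi$ divides $\alpha\beta$ but not $\beta$. *)

theory Defs
  imports
    "HOL-Library.Poly_Mapping"
    "HOL-Library.Countable"
    "HOL-Library.FSet"
    "HOL-Library.Z2"
    "HOL-Computational_Algebra.Fraction_Field"
    "HOL-Algebra.Generated_Rings"
    "HOL-Algebra.Algebraic_Closure_Type"
begin

section \<open>Factorization notions\<close>

text \<open>
  In HOL-Algebra neither \<^const>\<open>irreducible\<close> nor \<^const>\<open>ring_irreducible\<close>
  includes membership in the carrier, and \<^const>\<open>irreducible\<close> does not exclude zero.
\<close>

definition irreducibles :: "('a, 'b) ring_scheme \<Rightarrow> 'a set" where
  "irreducibles R = {p \<in> carrier R. ring_irreducible\<^bsub>R\<^esub> p}"

definition list_prod :: "('a, 'b) ring_scheme \<Rightarrow> 'a list \<Rightarrow> 'a" where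
  "list_prod R ps = foldr (\<otimes>\<^bsub>R\<^esub>) ps \<one>\<^bsub>R\<^esub>"

text \<open>The product is nonempty, so units (and zero) are never atomic.\<close>

definition atomic :: "('a, 'b) ring_scheme \<Rightarrow> 'a \<Rightarrow> bool" where
  "atomic R a \<longleftrightarrow> (\<exists>ps. ps \<noteq> [] \<and> set ps \<subseteq> irreducibles R \<and> a = list_prod R ps)"

definition nonzero_nonunits :: "('a, 'b) ring_scheme \<Rightarrow> 'a set" where
  "nonzero_nonunits R = {a \<in> carrier R. a \<noteq> \<zero>\<^bsub>R\<^esub> \<and> a \<notin> Units R}"

definition almost_atomic :: "('a, 'b) ring_scheme \<Rightarrow> bool" where
  "almost_atomic R \<longleftrightarrow>
     (\<forall>a \<in> nonzero_nonunits R. \<exists>ps. ps \<noteq> [] \<and> set ps \<subseteq> irreducibles R \<and>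
        atomic R (a \<otimes>\<^bsub>R\<^esub> list_prod R ps))"

definition semi_Furstenberg :: "('a, 'b) ring_scheme \<Rightarrow> bool" where
  "semi_Furstenberg R \<longleftrightarrow>
     (\<exists>b \<in> carrier R. \<forall>a \<in> nonzero_nonunits R. \<exists>p \<in> irreducibles R.
        p divides\<^bsub>R\<^esub> (a \<otimes>\<^bsub>R\<^esub> b) \<and> \<not> p divides\<^bsub>R\<^esub> b)"


section \<open>The ambient field\<close>

text \<open>
  All the rings live in one field, the fraction field of the polynomial ring over
  \<open>\<bbbF>\<^sub>2\<close> in countably many indeterminates with rational exponents (negative ones allowed).
  Each ring of the tower is countable, so countably many indeterminates suffice:
  \<open>z\<^sub>\<gamma>\<close> adjoined at stage \<open>n\<close> is the indeterminate \<open>VZ n (to_nat \<gamma>)\<close>.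
\<close>

datatype indet = VX nat | VY nat | VZ nat nat

instance indet :: countable
  by countable_datatype

text \<open>
  The order on indeterminates is irrelevant; the library only needs some linear order on them
  to show that the polynomials form an integral domain.
\<close>

instantiation indet :: linorder
begin

definition less_eq_indet :: "indet \<Rightarrow> indet \<Rightarrow> bool" where
  "less_eq_indet u v \<longleftrightarrow> to_nat u \<le> to_nat v"

definition less_indet :: "indet \<Rightarrow> indet \<Rightarrow> bool" where
  "less_indet u v \<longleftrightarrow> to_nat u < to_nat v"

instance
  by standard (auto simp: less_eq_indet_def less_indet_def)

end

instance bit :: countable
proof
  show "\<exists>f :: bit \<Rightarrow> nat. inj f"
    by (rule exI[of _ "\<lambda>b. if b = 0 then 0 else 1"]) (auto simp: inj_def split: if_splits)
qed

instance poly_mapping :: (countable, "{countable, zero}") countable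
proof
  define g :: "('a \<Rightarrow>\<^sub>0 'b) \<Rightarrow> ('a \<times> 'b) fset" where
    "g p = Abs_fset ((\<lambda>k. (k, Poly_Mapping.lookup p k)) ` Poly_Mapping.keys p)" for p
  have graph: "(k, c) \<in> fset (g p) \<longleftrightarrow> c = Poly_Mapping.lookup p k \<and> c \<noteq> 0" for p k c
    by (auto simp: g_def Abs_fset_inverse in_keys_iff)
  have "inj g"
  proof (rule injI, rule poly_mapping_eqI)
    fix p q k assume "g p = g q"
    then have "c = Poly_Mapping.lookup p k \<and> c \<noteq> 0 \<longleftrightarrow> c = Poly_Mapping.lookup q k \<and> c \<noteq> 0" for c
      using graph by metis
    then show "Poly_Mapping.lookup p k = Poly_Mapping.lookup q k"
      by metis
  qed
  then have "inj (\<lambda>p. to_nat (g p))"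
    by (simp add: inj_def)
  then show "\<exists>f :: ('a \<Rightarrow>\<^sub>0 'b) \<Rightarrow> nat. inj f"
    by blast
qed

instance fract :: ("{idom, countable}") countable
proof
  define h :: "'a \<times> 'a \<Rightarrow> 'a fract" where "h = (\<lambda>(a, b). Fract a b)"
  have "surj h"
    unfolding surj_def h_def by (metis Fract_cases case_prod_conv)
  then have "inj (inv_into UNIV h)"
    by (rule surj_imp_inj_inv)
  then have "inj (\<lambda>q. to_nat (inv_into UNIV h q))"
    by (simp add: inj_def)
  then show "\<exists>f :: 'a fract \<Rightarrow> nat. inj f"
    by blast
qed

type_synonym ambient = "((indet \<Rightarrow>\<^sub>0 rat) \<Rightarrow>\<^sub>0 bit) fract"

text \<open>The power of the indeterminate \<open>v\<close> with exponent \<open>q\<close>.\<close>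

definition ipow :: "indet \<Rightarrow> rat \<Rightarrow> ambient" where
  "ipow v q = Fract (Poly_Mapping.single (Poly_Mapping.single v q) 1) 1"

definition x_ind :: "nat \<Rightarrow> ambient" where
  "x_ind n = ipow (VX n) 1"

definition z_ind :: "nat \<Rightarrow> ambient \<Rightarrow> ambient" where
  "z_ind n \<gamma> = ipow (VZ n (to_nat \<gamma>)) 1"

definition Y_set :: "nat \<Rightarrow> ambient set" where
  "Y_set n = {ipow (VY n) q | q. q > 0}"

definition subring_on :: "ambient set \<Rightarrow> ambient ring" where
  "subring_on A = ring_of_type_algebra\<lparr>carrier := A\<rparr>"

text \<open>The subring \<open>A[S]\<close> of the ambient field.\<close>

definition adjoin :: "ambient set \<Rightarrow> ambient set \<Rightarrow> ambient set" where
  "adjoin A S = generate_ring ring_of_type_algebra (A \<union> S)"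


section \<open>The tower of rings\<close>

definition nonatomics :: "ambient set \<Rightarrow> ambient set" where
  "nonatomics A = {\<alpha> \<in> A. \<not> atomic (subring_on A) \<alpha>}"

text \<open>
  The polynomial and fraction ring extensions are rendered as subrings generated in the ambient
  field. This is the same ring because no element of \<open>R_set n\<close> involves the indeterminates of
  stage \<open>Suc n\<close>; see \<open>R_set_stage\<close> below.
\<close>

primrec R_set :: "nat \<Rightarrow> ambient set" where
  "R_set 0 = adjoin {0, 1} (Y_set 0)"
| "R_set (Suc n) =
     adjoin
       (adjoin
         (adjoin (R_set n) {z_ind (Suc n) \<gamma> | \<gamma>. \<gamma> \<in> nonatomics (R_set n)})
         {x_ind (Suc n) * \<gamma> / z_ind (Suc n) \<gamma> | \<gamma>. \<gamma> \<in> nonatomics (R_set n)})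
       (Y_set (Suc n))"

definition D_set :: "ambient set" where
  "D_set = (\<Union>n. R_set n)"

definition R_ring :: "nat \<Rightarrow> ambient ring" where
  "R_ring n = subring_on (R_set n)"

definition D_ring :: "ambient ring" where
  "D_ring = subring_on D_set"


section \<open>Basic facts on the tower\<close>

lemma ambient_simps [simp]:
  "carrier (ring_of_type_algebra :: ambient ring) = UNIV"
  "x \<otimes>\<^bsub>(ring_of_type_algebra :: ambient ring)\<^esub> y = x * y"
  "x \<oplus>\<^bsub>(ring_of_type_algebra :: ambient ring)\<^esub> y = x + y"
  "\<one>\<^bsub>(ring_of_type_algebra :: ambient ring)\<^esub> = 1"
  "\<zero>\<^bsub>(ring_of_type_algebra :: ambient ring)\<^esub> = 0"
  by (simp_all add: ring_of_type_algebra_def)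

lemma ambient_field: "field (ring_of_type_algebra :: ambient ring)"
  by (rule field_from_type_algebra)

lemma ambient_a_inv [simp]: "\<ominus>\<^bsub>(ring_of_type_algebra :: ambient ring)\<^esub> x = - x"
proof -
  interpret field "ring_of_type_algebra :: ambient ring" by (rule ambient_field)
  show ?thesis by (rule minus_equality) auto
qed

lemma adjoin_subring: "subring (adjoin A S) ring_of_type_algebra"
proof -
  interpret field "ring_of_type_algebra :: ambient ring" by (rule ambient_field)
  show ?thesis unfolding adjoin_def by (rule generate_ring_is_subring) simp
qed

lemma adjoin_incl: "A \<subseteq> adjoin A S" "S \<subseteq> adjoin A S"
  unfolding adjoin_def by (auto intro: generate_ring.incl)

lemma R_set_subring: "subring (R_set n) ring_of_type_algebra"
  by (cases n) (simp_all only: R_set.simps adjoin_subring)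

lemma R_set_Suc: "R_set n \<subseteq> R_set (Suc n)"
  unfolding R_set.simps using adjoin_incl(1) by (meson order_trans)

lemma R_set_mono: "m \<le> n \<Longrightarrow> R_set m \<subseteq> R_set n"
  by (rule lift_Suc_mono_le[of R_set]) (rule R_set_Suc)

lemma D_set_subring: "subring D_set ring_of_type_algebra"
proof -
  interpret field "ring_of_type_algebra :: ambient ring" by (rule ambient_field)
  note E = subringE[OF R_set_subring, simplified]
  have common: "\<exists>n. a \<in> R_set n \<and> b \<in> R_set n" if "a \<in> D_set" "b \<in> D_set" for a b
    using that R_set_mono unfolding D_set_def
    by (metis UN_iff max.cobounded1 max.cobounded2 subsetD)
  show ?thesis
  proof (rule subringI)
    fix a b assume "a \<in> D_set" "b \<in> D_set"
    with common obtain n where "a \<in> R_set n" "b \<in> R_set n" by blast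
    then show "a \<otimes>\<^bsub>ring_of_type_algebra\<^esub> b \<in> D_set"
      and "a \<oplus>\<^bsub>ring_of_type_algebra\<^esub> b \<in> D_set"
      using E(6,7)[of a n b] unfolding D_set_def by auto
  qed (use E(3,5) in \<open>auto simp: D_set_def\<close>)
qed

lemma subring_on_domain:
  assumes "subring A ring_of_type_algebra"
  shows "domain (subring_on A)"
proof -
  interpret field "ring_of_type_algebra :: ambient ring" by (rule ambient_field)
  show ?thesis
    unfolding subring_on_def
    by (rule subdomain_is_domain) (rule subdomainI'[OF assms])
qed

lemma R_ring_domain: "domain (R_ring n)"
  unfolding R_ring_def by (rule subring_on_domain[OF R_set_subring])

lemma D_ring_domain: "domain D_ring"
  unfolding D_ring_def by (rule subring_on_domain[OF D_set_subring])

primrec stage :: "indet \<Rightarrow> nat" where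
  "stage (VX n) = n"
| "stage (VY n) = n"
| "stage (VZ n k) = n"

definition poly_stage_le :: "nat \<Rightarrow> ((indet \<Rightarrow>\<^sub>0 rat) \<Rightarrow>\<^sub>0 bit) \<Rightarrow> bool" where
  "poly_stage_le n p \<longleftrightarrow>
     (\<forall>m \<in> Poly_Mapping.keys p. \<forall>v \<in> Poly_Mapping.keys m. stage v \<le> n)"

definition stage_le :: "nat \<Rightarrow> ambient set" where
  "stage_le n = {Fract p 1 | p. poly_stage_le n p}"

lemma poly_stage_le_simps [simp]: "poly_stage_le n 0" "poly_stage_le n 1"
  by (auto simp: poly_stage_le_def)

lemma poly_stage_le_uminus: "poly_stage_le n p \<Longrightarrow> poly_stage_le n (- p)"
  by (simp add: poly_stage_le_def)

lemma poly_stage_le_add: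
  assumes "poly_stage_le n p" "poly_stage_le n q"
  shows "poly_stage_le n (p + q)"
  using assms Poly_Mapping.keys_add[of p q] unfolding poly_stage_le_def by blast

lemma poly_stage_le_mult:
  assumes "poly_stage_le n p" "poly_stage_le n q"
  shows "poly_stage_le n (p * q)"
  unfolding poly_stage_le_def
proof (intro ballI)
  fix m v assume m: "m \<in> Poly_Mapping.keys (p * q)" and v: "v \<in> Poly_Mapping.keys m"
  from m obtain a b where ab: "m = a + b" "a \<in> Poly_Mapping.keys p" "b \<in> Poly_Mapping.keys q"
    using keys_mult[of p q] by blast
  then have "v \<in> Poly_Mapping.keys a \<or> v \<in> Poly_Mapping.keys b"
    using v Poly_Mapping.keys_add[of a b] by blast
  with ab assms show "stage v \<le> n"
    unfolding poly_stage_le_def by blast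
qed

lemma stage_le_mono: "m \<le> n \<Longrightarrow> stage_le m \<subseteq> stage_le n"
  unfolding stage_le_def poly_stage_le_def by (blast intro: order_trans)

lemma stage_le_ipow: "stage v \<le> n \<Longrightarrow> ipow v q \<in> stage_le n"
  unfolding stage_le_def ipow_def
  by (rule CollectI, rule exI, rule conjI[OF refl]) (auto simp: poly_stage_le_def split: if_splits)

lemma stage_le_add: "a \<in> stage_le n \<Longrightarrow> b \<in> stage_le n \<Longrightarrow> a + b \<in> stage_le n"
  unfolding stage_le_def using poly_stage_le_add by fastforce

lemma stage_le_mult: "a \<in> stage_le n \<Longrightarrow> b \<in> stage_le n \<Longrightarrow> a * b \<in> stage_le n"
  unfolding stage_le_def using poly_stage_le_mult by fastforce

lemma stage_le_uminus: "a \<in> stage_le n \<Longrightarrow> - a \<in> stage_le n"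
  unfolding stage_le_def using poly_stage_le_uminus by fastforce

lemma stage_le_0_1: "0 \<in> stage_le n" "1 \<in> stage_le n"
  unfolding stage_le_def Zero_fract_def One_fract_def using poly_stage_le_simps by blast+

lemma stage_le_adjoin:
  assumes "A \<subseteq> stage_le n" "S \<subseteq> stage_le n"
  shows "adjoin A S \<subseteq> stage_le n"
proof
  fix a assume "a \<in> adjoin A S"
  then show "a \<in> stage_le n"
    unfolding adjoin_def
    by (induction rule: generate_ring.induct)
       (use assms in \<open>auto intro: stage_le_0_1 stage_le_uminus stage_le_add stage_le_mult\<close>)
qed

lemma ipow_inverse: "inverse (ipow v q) = ipow v (- q)"
proof -
  have "ipow v q * ipow v (- q) = 1"
    unfolding ipow_def
    by (simp add: mult_single One_fract_def flip: single_add)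
  then show ?thesis
    by (rule inverse_unique)
qed

lemma R_set_stage: "R_set n \<subseteq> stage_le n"
proof (induction n)
  case 0
  have "Y_set 0 \<subseteq> stage_le 0"
    unfolding Y_set_def by (auto intro!: stage_le_ipow)
  moreover have "{0, 1} \<subseteq> stage_le 0"
    by (simp add: stage_le_0_1)
  ultimately show ?case by (simp add: stage_le_adjoin)
next
  case (Suc n)
  then have R: "R_set n \<subseteq> stage_le (Suc n)"
    using stage_le_mono[of n "Suc n"] by auto
  have Y: "Y_set (Suc n) \<subseteq> stage_le (Suc n)"
    unfolding Y_set_def by (auto intro!: stage_le_ipow)
  have X: "x_ind (Suc n) * \<gamma> / z_ind (Suc n) \<gamma> \<in> stage_le (Suc n)"
    if "\<gamma> \<in> nonatomics (R_set n)" for \<gamma>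
    using that R unfolding divide_inverse x_ind_def z_ind_def ipow_inverse nonatomics_def
    by (auto intro!: stage_le_mult stage_le_ipow)
  show ?case
    unfolding R_set.simps
    by (intro stage_le_adjoin R Y) (use X in \<open>auto simp: z_ind_def intro: stage_le_ipow\<close>)
qed

end

theory Submission
  imports Defs
begin

text \<open>
  Grade \<open>R\<^sub>n\<^sub>+\<^sub>1\<close> by the monomials in the indeterminates of stage \<open>n + 1\<close>, and give \<open>x\<close>, \<open>y\<close>, \<open>z\<^sub>\<gamma>\<close> the
  weights 2, 0, 1. Then the generators \<open>z\<^sub>\<gamma>\<close> and \<open>x \<gamma> / z\<^sub>\<gamma>\<close> have weight 1, so all weights in \<open>R\<^sub>n\<^sub>+\<^sub>1\<close>
  are natural numbers, and weight 0 leaves only \<open>R\<^sub>n[Y\<^sub>n\<^sub>+\<^sub>1]\<close>. Moreover the coefficients in degree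
  \<open>x / z\<^sub>\<gamma>\<close> lie in \<open>\<gamma> R\<^sub>n\<close>. Factors of homogeneous elements are homogeneous. Hence divisors in
  \<open>R\<^sub>n\<^sub>+\<^sub>1\<close> of nonzero elements of \<open>R\<^sub>n\<close> lie in \<open>R\<^sub>n\<close>, so irreducibles stay irreducible up to \<open>D\<close>, and
  \<open>z\<^sub>\<gamma>\<close> and \<open>x \<gamma> / z\<^sub>\<gamma>\<close> (for \<open>\<gamma> \<noteq> 0\<close>) are irreducible.

  Almost atomic: the unit 1 is not atomic, so \<open>x = z\<^sub>1 (x / z\<^sub>1)\<close> is a product of irreducibles, and for
  nonatomic \<open>\<gamma>\<close> so is \<open>x \<gamma> = z\<^sub>\<gamma> (x \<gamma> / z\<^sub>\<gamma>)\<close>.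

  Not semi-Furstenberg: given \<open>\<beta> \<in> R\<^sub>n\<close>, take \<open>\<alpha> = y\<^sub>n\<^sub>+\<^sub>1\<close>. A divisor of \<open>\<alpha> \<beta> \<noteq> 0\<close> has the form \<open>y\<^sup>q d\<close>
  with \<open>d\<close> dividing \<open>\<beta>\<close> in \<open>R\<^sub>n\<close>, and if it is irreducible then \<open>q = 0\<close>, because \<open>y\<^sup>q = (y\<^sup>q\<^sup>/\<^sup>2)\<^sup>2\<close>.
\<close>

section \<open>Gradings of polynomial rings\<close>

lemma poly_mapping_expand:
  "(\<Sum>k\<in>Poly_Mapping.keys f. Poly_Mapping.single k (Poly_Mapping.lookup f k)) = f"
proof (rule poly_mapping_eqI)
  fix k
  show "Poly_Mapping.lookup (\<Sum>k\<in>Poly_Mapping.keys f. Poly_Mapping.single k (Poly_Mapping.lookup f k)) k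
      = Poly_Mapping.lookup f k"
    by (cases "k \<in> Poly_Mapping.keys f")
       (auto simp: lookup_sum lookup_single when_def in_keys_iff)
qed

lemma poly_mapping_mult_expand:
  fixes f g :: "'a::comm_monoid_add \<Rightarrow>\<^sub>0 'b::comm_semiring_1"
  shows "f * g = (\<Sum>a\<in>Poly_Mapping.keys f. \<Sum>b\<in>Poly_Mapping.keys g.
    Poly_Mapping.single (a + b) (Poly_Mapping.lookup f a * Poly_Mapping.lookup g b))"
proof -
  have "f * g = (\<Sum>a\<in>Poly_Mapping.keys f. Poly_Mapping.single a (Poly_Mapping.lookup f a)) *
      (\<Sum>b\<in>Poly_Mapping.keys g. Poly_Mapping.single b (Poly_Mapping.lookup g b))"
    by (simp only: poly_mapping_expand)
  also have "\<dots> = (\<Sum>a\<in>Poly_Mapping.keys f. \<Sum>b\<in>Poly_Mapping.keys g.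
    Poly_Mapping.single (a + b) (Poly_Mapping.lookup f a * Poly_Mapping.lookup g b))"
    by (simp only: sum_product mult_single)
  finally show ?thesis .
qed

text \<open>Each coefficient of a product is a finite sum of products of coefficients whose degrees
  add up. This gives closure of \<open>graded_set\<close> under products.\<close>

lemma lookup_mult_closed:
  fixes f g :: "'a::comm_monoid_add \<Rightarrow>\<^sub>0 'b::comm_semiring_1"
  assumes zero: "\<And>m. P m 0"
    and add: "\<And>m a b. P m a \<Longrightarrow> P m b \<Longrightarrow> P m (a + b)"
    and mult: "\<And>m m' a b. P m a \<Longrightarrow> P m' b \<Longrightarrow> P (m + m') (a * b)"
    and f: "\<And>m. P m (Poly_Mapping.lookup f m)" and g: "\<And>m. P m (Poly_Mapping.lookup g m)"
  shows "P m (Poly_Mapping.lookup (f * g) m)"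
proof -
  have sum: "P m (sum h A)" if "\<And>a. a \<in> A \<Longrightarrow> P m (h a)" for h :: "'a \<Rightarrow> 'b" and A
    using that by (induction A rule: infinite_finite_induct) (auto intro: zero add)
  show ?thesis
    unfolding poly_mapping_mult_expand[of f g] lookup_sum
    by (intro sum) (auto simp: lookup_single when_def intro: zero mult f g)
qed

section \<open>Factors of a single term\<close>

lemma add_le_eq_add_imp_eq:
  fixes a b c d :: "'a::linordered_ab_group_add"
  assumes "a \<le> c" "b \<le> d" "a + b = c + d"
  shows "a = c \<and> b = d"
proof -
  have "c + b \<le> c + d" "a + d \<le> c + d"
    using assms(1,2) by simp_all
  then have "c + b \<le> a + b" "a + d \<le> a + b"
    unfolding assms(3) by simp_all
  then show ?thesis
    using assms(1,2) by simp
qed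

text \<open>The largest exponents of \<open>f\<close> and \<open>g\<close> add up to an exponent of
  \<open>f * g\<close>, and so do the smallest. Both sums must be \<open>m\<close>, so in each
  factor the largest and the smallest exponent agree.\<close>

lemma mult_eq_single_imp_single:
  fixes f g :: "'a::linordered_ab_group_add \<Rightarrow>\<^sub>0 'b::idom"
  assumes fg: "f * g = Poly_Mapping.single m c" and "c \<noteq> 0"
  obtains a b d e where "f = Poly_Mapping.single a d" "g = Poly_Mapping.single b e"
proof -
  let ?K = Poly_Mapping.keys and ?l = Poly_Mapping.lookup
  have "Poly_Mapping.single m c \<noteq> 0"
    using \<open>c \<noteq> 0\<close> by (metis lookup_single_eq lookup_zero)
  then have "f \<noteq> 0" "g \<noteq> 0"
    unfolding fg[symmetric] by auto
  then have ne: "?K f \<noteq> {}" "?K g \<noteq> {}"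
    by auto
  \<comment> \<open>A sum of exponents that arises from only one pair cannot cancel, because the
    coefficients lie in a domain.\<close>
  have extreme: "a + b = m" if a: "a \<in> ?K f" and b: "b \<in> ?K g"
    and unique: "\<And>a' b'. a' \<in> ?K f \<Longrightarrow> b' \<in> ?K g \<Longrightarrow> a' + b' = a + b \<Longrightarrow> a' = a \<and> b' = b" for a b
  proof -
    have "?l (f * g) (a + b) =
      (\<Sum>a'\<in>?K f. \<Sum>b'\<in>?K g. if a' = a then if b' = b then ?l f a' * ?l g b' else 0 else 0)"
      unfolding poly_mapping_mult_expand[of f g] lookup_sum
      by (intro sum.cong refl) (use unique in \<open>auto simp: lookup_single when_def\<close>)
    also have "\<dots> = (\<Sum>a'\<in>?K f. if a' = a then ?l f a * ?l g b else 0)"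
      by (intro sum.cong refl) (auto simp: b)
    also have "\<dots> = ?l f a * ?l g b"
      by (simp add: a)
    finally have "?l (f * g) (a + b) \<noteq> 0"
      using a b by (simp add: in_keys_iff)
    then show ?thesis
      unfolding fg by (auto simp: lookup_single when_def split: if_splits)
  qed
  have max: "Max (?K f) + Max (?K g) = m"
  proof (rule extreme)
    fix a b assume "a \<in> ?K f" "b \<in> ?K g" and eq: "a + b = Max (?K f) + Max (?K g)"
    then show "a = Max (?K f) \<and> b = Max (?K g)"
      by (intro add_le_eq_add_imp_eq) auto
  qed (use ne in auto)
  have min: "Min (?K f) + Min (?K g) = m"
  proof (rule extreme)
    fix a b assume "a \<in> ?K f" "b \<in> ?K g" and eq: "a + b = Min (?K f) + Min (?K g)"
    then have "Min (?K f) = a \<and> Min (?K g) = b"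
      by (intro add_le_eq_add_imp_eq) auto
    then show "a = Min (?K f) \<and> b = Min (?K g)"
      by simp
  qed (use ne in auto)
  have le: "Min (?K f) \<le> Max (?K f)" "Min (?K g) \<le> Max (?K g)"
    using ne by auto
  have eq: "Min (?K f) = Max (?K f)" "Min (?K g) = Max (?K g)"
    using add_le_eq_add_imp_eq[OF le] max min by simp_all
  have single: "\<exists>a d. h = Poly_Mapping.single a d"
    if eq: "Min (?K h) = Max (?K h)" and ne: "?K h \<noteq> {}" for h :: "'a \<Rightarrow>\<^sub>0 'b"
  proof -
    have "k = Max (?K h)" if "k \<in> ?K h" for k
      using Min_le[OF finite_keys that] Max_ge[OF finite_keys that] eq by simp
    then obtain a where "?K h = {a}"
      using ne by blast
    then have "h = Poly_Mapping.single a (?l h a)"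
      using poly_mapping_expand[of h] by simp
    then show ?thesis
      by blast
  qed
  show thesis
    using single[OF eq(1) ne(1)] single[OF eq(2) ne(2)] that by blast
qed

text \<open>
  For additive \<open>h\<close>, the coefficient of \<open>components h p\<close> at \<open>m\<close> is the homogeneous component of
  \<open>p\<close> of degree \<open>m\<close> in the grading that \<open>h\<close> induces. Keeping the components as coefficients makes
  this a ring homomorphism, into a ring that is known to be a domain.
\<close>

definition components :: "('a \<Rightarrow> 'b) \<Rightarrow> ('a \<Rightarrow>\<^sub>0 'c::comm_semiring_1) \<Rightarrow> 'b \<Rightarrow>\<^sub>0 ('a \<Rightarrow>\<^sub>0 'c)" where
  "components h p = (\<Sum>k\<in>Poly_Mapping.keys p.
     Poly_Mapping.single (h k) (Poly_Mapping.single k (Poly_Mapping.lookup p k)))"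

lemma components_single [simp]:
  "components h (Poly_Mapping.single k c) = Poly_Mapping.single (h k) (Poly_Mapping.single k c)"
  by (cases "c = 0") (auto simp: components_def)

lemma components_0 [simp]: "components h 0 = 0"
  by (simp add: components_def)

lemma components_add: "components h (p + q) = components h p + components h q"
  unfolding components_def
  by (rule setsum_keys_plus_distrib) (simp_all add: single_add)

lemma components_sum: "components h (sum f A) = (\<Sum>a\<in>A. components h (f a))"
  by (induction A rule: infinite_finite_induct) (auto simp: components_add)

lemma components_uminus:
  fixes p :: "'a \<Rightarrow>\<^sub>0 'c::comm_ring_1"
  shows "components h (- p) = - components h p"
  using components_add[of h p "- p"] by (simp add: add_eq_0_iff)

lemma components_mult:
  fixes p q :: "'a::comm_monoid_add \<Rightarrow>\<^sub>0 'c::comm_semiring_1"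
  assumes h: "\<And>a b. h (a + b) = h a + (h b :: 'b::comm_monoid_add)"
  shows "components h (p * q) = components h p * components h q"
proof -
  have "components h (p * q) = (\<Sum>a\<in>Poly_Mapping.keys p. \<Sum>b\<in>Poly_Mapping.keys q.
      Poly_Mapping.single (h a) (Poly_Mapping.single a (Poly_Mapping.lookup p a)) *
      Poly_Mapping.single (h b) (Poly_Mapping.single b (Poly_Mapping.lookup q b)))"
    unfolding poly_mapping_mult_expand[of p q] components_sum
    by (simp add: mult_single h)
  then show ?thesis
    by (simp only: components_def sum_product)
qed

lemma components_homogeneous:
  fixes p :: "'a \<Rightarrow>\<^sub>0 'c::comm_semiring_1" and m :: 'b
  assumes "\<And>k. k \<in> Poly_Mapping.keys p \<Longrightarrow> h k = m"
  shows "components h p = Poly_Mapping.single m p"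
proof -
  have sum: "(\<Sum>k\<in>A. Poly_Mapping.single m (f k)) = Poly_Mapping.single m (sum f A)"
    for f :: "'a \<Rightarrow> 'a \<Rightarrow>\<^sub>0 'c" and A
    by (induction A rule: infinite_finite_induct) (auto simp: single_add)
  show ?thesis
    using assms by (simp add: components_def sum poly_mapping_expand)
qed

text \<open>Adding up all coefficients of \<open>components h p\<close> recovers \<open>p\<close>;
  \<open>?t\<close> is this sum.\<close>

lemma components_eq_single_imp:
  fixes p g :: "'a \<Rightarrow>\<^sub>0 'c::comm_semiring_1" and m :: 'b
  assumes "components h p = Poly_Mapping.single m g"
  shows "g = p"
proof -
  let ?t = "\<lambda>F. \<Sum>m\<in>Poly_Mapping.keys F. Poly_Mapping.lookup F m"
  have t_add: "?t (F + G) = ?t F + ?t G" for F G :: "'b \<Rightarrow>\<^sub>0 ('a \<Rightarrow>\<^sub>0 'c)"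
    by (rule setsum_keys_plus_distrib) simp_all
  have t_single: "?t (Poly_Mapping.single m x) = x" for m :: 'b and x :: "'a \<Rightarrow>\<^sub>0 'c"
    by (cases "x = 0") auto
  have t_sum: "?t (sum f A) = (\<Sum>a\<in>A. ?t (f a))" for f :: "'a \<Rightarrow> 'b \<Rightarrow>\<^sub>0 ('a \<Rightarrow>\<^sub>0 'c)" and A
    by (induction A rule: infinite_finite_induct) (simp_all add: t_add)
  have "?t (components h p) = p"
    unfolding components_def t_sum t_single by (rule poly_mapping_expand)
  then show ?thesis
    using assms t_single by metis
qed


section \<open>Monomials of one stage\<close>

text \<open>Taken at \<open>Suc n\<close>, this is the degree map passed to
  \<open>components\<close>; elements of \<open>R_set n\<close> then have degree 0.\<close>

definition stage_part :: "nat \<Rightarrow> (indet \<Rightarrow>\<^sub>0 rat) \<Rightarrow> indet \<Rightarrow>\<^sub>0 rat" where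
  "stage_part n = Poly_Mapping.mapp (\<lambda>v q. if stage v = n then q else 0)"

lemma lookup_stage_part:
  "Poly_Mapping.lookup (stage_part n k) v = (if stage v = n then Poly_Mapping.lookup k v else 0)"
  by (auto simp: stage_part_def lookup_mapp when_def in_keys_iff)

lemma stage_part_add: "stage_part n (a + b) = stage_part n a + stage_part n b"
  by (rule poly_mapping_eqI) (simp add: lookup_stage_part lookup_add)

lemma stage_part_diff: "stage_part n (a - b) = stage_part n a - stage_part n b"
  by (rule poly_mapping_eqI) (simp add: lookup_stage_part lookup_minus)

lemma stage_part_single [simp]:
  "stage v = n \<Longrightarrow> stage_part n (Poly_Mapping.single v q) = Poly_Mapping.single v q"
  by (rule poly_mapping_eqI) (auto simp: lookup_stage_part lookup_single when_def)

lemma stage_part_0 [simp]: "stage_part n 0 = 0"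
  by (rule poly_mapping_eqI) (simp add: lookup_stage_part)

lemma stage_part_eq_0: "(\<And>v. v \<in> Poly_Mapping.keys k \<Longrightarrow> stage v \<noteq> n) \<Longrightarrow> stage_part n k = 0"
  by (rule poly_mapping_eqI) (auto simp: lookup_stage_part in_keys_iff)

section \<open>Weights and admissible degrees\<close>

primrec var_weight :: "indet \<Rightarrow> rat" where
  "var_weight (VX n) = 2"
| "var_weight (VY n) = 0"
| "var_weight (VZ n k) = 1"

definition weight :: "(indet \<Rightarrow>\<^sub>0 rat) \<Rightarrow> rat" where
  "weight m = (\<Sum>v\<in>Poly_Mapping.keys m. var_weight v * Poly_Mapping.lookup m v)"

lemma weight_add: "weight (a + b) = weight a + weight b"
  unfolding weight_def by (rule setsum_keys_plus_distrib) (simp_all add: algebra_simps)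

lemma weight_single [simp]: "weight (Poly_Mapping.single v q) = var_weight v * q"
  by (cases "q = 0") (auto simp: weight_def)

lemma weight_0 [simp]: "weight 0 = 0"
  by (simp add: weight_def)

lemma weight_diff: "weight (a - b) = weight a - weight b"
  using weight_add[of "a - b" b] by simp

text \<open>The generators adjoined at a positive stage \<open>n\<close> have such degrees and the
  condition survives addition, so it holds for all degrees that occur in \<open>R_set n\<close>. The
  last clause excludes monomials of weight 0 such as \<open>x / z^2\<close>.\<close>

definition admissible :: "nat \<Rightarrow> (indet \<Rightarrow>\<^sub>0 rat) \<Rightarrow> bool" where
  "admissible n m \<longleftrightarrow> weight m \<in> \<nat> \<and> Poly_Mapping.lookup m (VY n) \<ge> 0 \<and>
     (weight m = 0 \<longrightarrow> Poly_Mapping.keys m \<subseteq> {VY n})"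

lemma admissible_0 [simp]: "admissible n 0"
  by (simp add: admissible_def)

text \<open>Weights are nonnegative, so a sum of weight 0 has both summands of weight 0, where only
  \<open>VY n\<close> can occur.\<close>

lemma admissible_add:
  assumes "admissible n a" "admissible n b"
  shows "admissible n (a + b)"
proof -
  have "weight a \<ge> 0" "weight b \<ge> 0"
    using assms by (auto simp: admissible_def elim!: Nats_cases)
  then have "weight a = 0 \<and> weight b = 0" if "weight (a + b) = 0"
    using that by (simp add: weight_add add_nonneg_eq_0_iff)
  then show ?thesis
    using assms keys_add[of a b] unfolding admissible_def
    by (auto simp: weight_add lookup_add)
qed

lemma only_key_imp_single:
  assumes "Poly_Mapping.keys m \<subseteq> {v}"
  shows "m = Poly_Mapping.single v (Poly_Mapping.lookup m v)"
  using assms by (intro poly_mapping_eqI) (auto simp: lookup_single when_def in_keys_iff)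

lemma admissible_weight_0:
  assumes "admissible n a" "weight a = 0"
  obtains q where "q \<ge> 0" "a = Poly_Mapping.single (VY n) q"
  using assms only_key_imp_single[of a "VY n"] unfolding admissible_def by blast

lemma admissible_sum_weight_0:
  assumes "admissible n a" "admissible n b" "weight (a + b) = 0"
  shows "weight a = 0" "weight b = 0"
proof -
  have "weight a \<ge> 0" "weight b \<ge> 0"
    using assms by (auto simp: admissible_def elim!: Nats_cases)
  then show "weight a = 0" "weight b = 0"
    using assms(3) by (simp_all add: weight_add add_nonneg_eq_0_iff)
qed

text \<open>One of two natural weights with sum 1 is 0. That summand is a power of \<open>y\<close>,
  with exponent 0 because the two nonnegative \<open>y\<close>-exponents cancel out. Hence the
  degrees of \<open>z\<^sub>\<gamma>\<close> and \<open>x / z\<^sub>\<gamma>\<close> are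
  indecomposable.\<close>

lemma admissible_sum_weight_1:
  assumes "admissible n a" "admissible n b" "weight (a + b) = 1"
    and y: "Poly_Mapping.lookup (a + b) (VY n) = 0"
  shows "a = 0 \<or> b = 0"
proof -
  obtain i j :: nat where ij: "weight a = of_nat i" "weight b = of_nat j"
    using assms(1,2) by (auto simp: admissible_def elim!: Nats_cases)
  then have "(of_nat (i + j) :: rat) = of_nat 1"
    using assms(3) by (simp add: weight_add)
  then have "i + j = 1"
    by (simp only: of_nat_eq_iff)
  then have "weight a = 0 \<or> weight b = 0"
    using ij by (cases i) auto
  moreover have "Poly_Mapping.lookup a (VY n) = 0" "Poly_Mapping.lookup b (VY n) = 0"
    using assms(1,2) y by (auto simp: admissible_def lookup_add add_nonneg_eq_0_iff)
  ultimately show ?thesis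
    using assms(1,2) admissible_weight_0 by (metis lookup_single_eq single_zero)
qed

text \<open>Both summands have weight 0, so they are nonnegative powers of \<open>y\<close> whose
  exponents add up to 0.\<close>

lemma admissible_sum_0:
  assumes "admissible n a" "admissible n b" "a + b = 0"
  shows "a = 0" "b = 0"
proof -
  obtain q where q: "q \<ge> 0" "a = Poly_Mapping.single (VY n) q"
    using admissible_sum_weight_0[of n a b] assms by (auto elim: admissible_weight_0)
  obtain r where r: "r \<ge> 0" "b = Poly_Mapping.single (VY n) r"
    using admissible_sum_weight_0[of n a b] assms by (auto elim: admissible_weight_0)
  have "Poly_Mapping.lookup (a + b) (VY n) = 0"
    using assms(3) by simp
  then have "q + r = 0"
    by (simp add: q r lookup_add)
  then show "a = 0" "b = 0"
    using q r by (auto simp: add_nonneg_eq_0_iff)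
qed

text \<open>The exponent of \<open>x / z\<^sub>\<gamma>\<close>, with \<open>j\<close> standing for
  \<open>to_nat \<gamma>\<close>.\<close>

definition xz_mono :: "nat \<Rightarrow> nat \<Rightarrow> (indet \<Rightarrow>\<^sub>0 rat)" where
  "xz_mono n j = Poly_Mapping.single (VX n) 1 - Poly_Mapping.single (VZ n j) 1"

lemma lookup_xz_mono:
  "Poly_Mapping.lookup (xz_mono n j) v = (if v = VX n then 1 else if v = VZ n j then -1 else 0)"
  by (auto simp: xz_mono_def lookup_minus lookup_single when_def)

lemma xz_mono_inj: "xz_mono n i = xz_mono n j \<longleftrightarrow> i = j"
proof
  assume "xz_mono n i = xz_mono n j"
  then have "Poly_Mapping.lookup (xz_mono n i) (VZ n i) = Poly_Mapping.lookup (xz_mono n j) (VZ n i)"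
    by simp
  then show "i = j"
    by (simp add: lookup_xz_mono split: if_splits)
qed simp

lemma weight_xz_mono [simp]: "weight (xz_mono n j) = 1"
  by (simp add: xz_mono_def weight_diff)

lemma admissible_generators:
  "admissible n (Poly_Mapping.single (VZ n j) 1)"
  "admissible n (xz_mono n j)"
  "q \<ge> 0 \<Longrightarrow> admissible n (Poly_Mapping.single (VY n) q)"
  by (auto simp: admissible_def lookup_xz_mono lookup_single when_def)

section \<open>Monomials in the ambient field\<close>

definition monomial :: "(indet \<Rightarrow>\<^sub>0 rat) \<Rightarrow> ambient" where
  "monomial m = Fract (Poly_Mapping.single m 1) 1"

lemma monomial_0 [simp]: "monomial 0 = 1"
  by (simp add: monomial_def One_fract_def)

lemma monomial_add: "monomial (a + b) = monomial a * monomial b"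
  by (simp add: monomial_def mult_single)

lemma monomial_nonzero [simp]: "monomial m \<noteq> 0"
  using monomial_add[of m "- m"] by auto

lemma ipow_monomial: "ipow v q = monomial (Poly_Mapping.single v q)"
  by (simp add: ipow_def monomial_def)

lemma z_ind_monomial: "z_ind n \<gamma> = monomial (Poly_Mapping.single (VZ n (to_nat \<gamma>)) 1)"
  by (simp add: z_ind_def ipow_monomial)

lemma xz_mono_eq: "x_ind n * \<gamma> / z_ind n \<gamma> = monomial (xz_mono n (to_nat \<gamma>)) * \<gamma>"
proof -
  have "x_ind n = monomial (xz_mono n (to_nat \<gamma>)) * z_ind n \<gamma>"
    by (simp add: x_ind_def z_ind_def ipow_monomial xz_mono_def flip: monomial_add)
  moreover have "z_ind n \<gamma> \<noteq> 0"
    by (simp add: z_ind_monomial)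
  ultimately show ?thesis
    by simp
qed


section \<open>The grading of the next ring of the tower\<close>

declare R_set.simps(2) [simp del]

lemmas R_set_closed = subringE[OF R_set_subring, simplified]

text \<open>The last clause records that \<open>x / z\<^sub>\<gamma>\<close> enters the ring only
  together with a factor \<open>\<gamma>\<close>; the irreducibility of
  \<open>x \<gamma> / z\<^sub>\<gamma>\<close> rests on it.\<close>

definition admissible_coeff :: "nat \<Rightarrow> (indet \<Rightarrow>\<^sub>0 rat) \<Rightarrow> ambient \<Rightarrow> bool" where
  "admissible_coeff n m c \<longleftrightarrow> c \<in> R_set n \<and> admissible (Suc n) m \<and>
     (\<forall>\<gamma>. m = xz_mono (Suc n) (to_nat \<gamma>) \<longrightarrow> (\<exists>t\<in>R_set n. c = \<gamma> * t))"

lemma admissible_coeff_add: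
  assumes "admissible_coeff n m c" "admissible_coeff n m d"
  shows "admissible_coeff n m (c + d)"
  using assms R_set_closed(7)[of _ n] unfolding admissible_coeff_def
  by (metis distrib_left)

lemma admissible_coeff_uminus:
  assumes "admissible_coeff n m c"
  shows "admissible_coeff n m (- c)"
  using assms R_set_closed(5)[of _ n] unfolding admissible_coeff_def
  by (metis mult_minus_right)

text \<open>The degree \<open>xz_mono\<close> splits only as itself plus 0, so one of the two
  coefficients already carries the factor \<open>\<gamma>\<close>.\<close>

lemma admissible_coeff_mult:
  assumes c: "admissible_coeff n a c" and d: "admissible_coeff n b d"
  shows "admissible_coeff n (a + b) (c * d)"
proof -
  have "\<exists>t\<in>R_set n. c * d = \<gamma> * t" if eq: "a + b = xz_mono (Suc n) (to_nat \<gamma>)" for \<gamma>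
  proof -
    have "a = 0 \<or> b = 0"
      using c d eq by (intro admissible_sum_weight_1[of "Suc n"])
        (auto simp: admissible_coeff_def lookup_xz_mono)
    then show ?thesis
    proof
      assume "a = 0"
      then obtain t where "t \<in> R_set n" "d = \<gamma> * t"
        using d eq unfolding admissible_coeff_def by auto
      then show ?thesis
        using c R_set_closed(6)[of c n t] unfolding admissible_coeff_def
        by (intro bexI[of _ "c * t"]) auto
    next
      assume "b = 0"
      then obtain t where "t \<in> R_set n" "c = \<gamma> * t"
        using c eq unfolding admissible_coeff_def by auto
      then show ?thesis
        using d R_set_closed(6)[of t n d] unfolding admissible_coeff_def
        by (intro bexI[of _ "t * d"]) auto
    qed
  qed
  then show ?thesis
    using c d R_set_closed(6)[of c n d] unfolding admissible_coeff_def
    by (auto intro: admissible_add)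
qed

text \<open>Here \<open>g\<close> still contains its monomial, while \<open>c\<close> is the
  coefficient proper. The case \<open>g = 0\<close> covers the degrees that are not
  admissible.\<close>

definition admissible_component ::
    "nat \<Rightarrow> (indet \<Rightarrow>\<^sub>0 rat) \<Rightarrow> ((indet \<Rightarrow>\<^sub>0 rat) \<Rightarrow>\<^sub>0 bit) \<Rightarrow> bool" where
  "admissible_component n m g \<longleftrightarrow>
     g = 0 \<or> (\<exists>c. admissible_coeff n m c \<and> Fract g 1 = monomial m * c)"

lemma admissible_component_add:
  assumes "admissible_component n m g" "admissible_component n m h"
  shows "admissible_component n m (g + h)"
proof (cases "g = 0 \<or> h = 0")
  case False
  then obtain c d where "admissible_coeff n m c" "Fract g 1 = monomial m * c"
    "admissible_coeff n m d" "Fract h 1 = monomial m * d"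
    using assms by (auto simp: admissible_component_def)
  moreover have "Fract (g + h) 1 = Fract g 1 + Fract h 1"
    by simp
  ultimately have "admissible_coeff n m (c + d)" "Fract (g + h) 1 = monomial m * (c + d)"
    by (auto simp: admissible_coeff_add distrib_left simp del: add_fract)
  then show ?thesis
    by (auto simp: admissible_component_def)
qed (use assms in auto)

lemma admissible_component_uminus:
  assumes "admissible_component n m g"
  shows "admissible_component n m (- g)"
proof (cases "g = 0")
  case False
  then obtain c where c: "admissible_coeff n m c" "Fract g 1 = monomial m * c"
    using assms by (auto simp: admissible_component_def)
  have "Fract (- g) 1 = - Fract g 1"
    by simp
  then have "admissible_coeff n m (- c)" "Fract (- g) 1 = monomial m * - c"
    using c by (simp_all only: admissible_coeff_uminus mult_minus_right)
  then show ?thesis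
    by (auto simp: admissible_component_def)
qed (use assms in simp)

lemma admissible_component_mult:
  assumes "admissible_component n a g" "admissible_component n b h"
  shows "admissible_component n (a + b) (g * h)"
proof (cases "g = 0 \<or> h = 0")
  case False
  then obtain c d where "admissible_coeff n a c" "Fract g 1 = monomial a * c"
    "admissible_coeff n b d" "Fract h 1 = monomial b * d"
    using assms by (auto simp: admissible_component_def)
  moreover have "Fract (g * h) 1 = Fract g 1 * Fract h 1"
    by simp
  ultimately have "admissible_coeff n (a + b) (c * d)" "Fract (g * h) 1 = monomial (a + b) * (c * d)"
    by (auto simp: admissible_coeff_mult monomial_add simp del: mult_fract)
  then show ?thesis
    by (auto simp: admissible_component_def)
qed (auto simp: admissible_component_def)

section \<open>A graded ring containing the next ring\<close>

definition graded_set :: "nat \<Rightarrow> ambient set" where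
  "graded_set n = {Fract p 1 | p. \<forall>m. admissible_component n m
     (Poly_Mapping.lookup (components (stage_part (Suc n)) p) m)}"

text \<open>As \<open>p\<close> involves only indeterminates of stage at most \<open>n\<close>, it
  is homogeneous of degree 0, and multiplying by the monomial shifts the degree to
  \<open>m\<close>.\<close>

lemma components_monomial_stage_le:
  assumes "poly_stage_le n p" "stage_part (Suc n) m = m"
  shows "components (stage_part (Suc n)) (Poly_Mapping.single m 1 * p) =
    Poly_Mapping.single m (Poly_Mapping.single m 1 * p)"
proof -
  have "components (stage_part (Suc n)) p = Poly_Mapping.single 0 p"
    using assms(1) by (intro components_homogeneous stage_part_eq_0)
      (fastforce simp: poly_stage_le_def)
  then show ?thesis
    by (simp add: components_mult stage_part_add mult_single assms(2))
qed

lemma monomial_coeff_in_graded_set: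
  assumes m: "stage_part (Suc n) m = m" and c: "admissible_coeff n m c"
  shows "monomial m * c \<in> graded_set n"
proof -
  obtain p where p: "c = Fract p 1" "poly_stage_le n p"
    using c R_set_stage[of n] by (auto simp: admissible_coeff_def stage_le_def)
  have eq: "monomial m * c = Fract (Poly_Mapping.single m 1 * p) 1"
    by (simp add: monomial_def p)
  have "admissible_component n k
      (Poly_Mapping.lookup (components (stage_part (Suc n)) (Poly_Mapping.single m 1 * p)) k)" for k
    unfolding components_monomial_stage_le[OF p(2) m] using c eq
    by (auto simp: admissible_component_def lookup_single when_def)
  then show ?thesis
    unfolding graded_set_def eq by blast
qed

lemma graded_set_adjoin:
  assumes "A \<subseteq> graded_set n" "S \<subseteq> graded_set n"
  shows "adjoin A S \<subseteq> graded_set n"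
proof
  fix a assume "a \<in> adjoin A S"
  then show "a \<in> graded_set n"
    unfolding adjoin_def
  proof (induction rule: generate_ring.induct)
    case one
    \<comment> \<open>The degree 0 is never an \<open>xz_mono\<close>, so divisibility by
      \<open>\<gamma>\<close> is vacuous.\<close>
    have "admissible_coeff n 0 1"
    proof -
      have "0 \<noteq> xz_mono (Suc n) j" for j
        using lookup_xz_mono[of "Suc n" j "VX (Suc n)"] by auto
      then show ?thesis
        using R_set_closed(3)[of n] by (auto simp: admissible_coeff_def)
    qed
    then have "monomial 0 * 1 \<in> graded_set n"
      by (intro monomial_coeff_in_graded_set) auto
    then show ?case
      by simp
  next
    case (incl h)
    then show ?case
      using assms by blast
  next
    case (a_inv h)
    then show ?case
      by (fastforce simp: graded_set_def components_uminus intro: admissible_component_uminus)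
  next
    case (eng_add g h)
    then obtain p q where "g = Fract p 1" "h = Fract q 1"
      "\<And>m. admissible_component n m (Poly_Mapping.lookup (components (stage_part (Suc n)) p) m)"
      "\<And>m. admissible_component n m (Poly_Mapping.lookup (components (stage_part (Suc n)) q) m)"
      by (auto simp: graded_set_def)
    then show ?case
      unfolding graded_set_def
      by (auto intro!: exI[of _ "p + q"] admissible_component_add simp: components_add lookup_add)
  next
    case (eng_mult g h)
    then obtain p q where "g = Fract p 1" "h = Fract q 1"
      "\<And>m. admissible_component n m (Poly_Mapping.lookup (components (stage_part (Suc n)) p) m)"
      "\<And>m. admissible_component n m (Poly_Mapping.lookup (components (stage_part (Suc n)) q) m)"
      by (auto simp: graded_set_def)
    moreover from this have "admissible_component n m
        (Poly_Mapping.lookup (components (stage_part (Suc n)) (p * q)) m)" for m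
      unfolding components_mult[of "stage_part (Suc n)", OF stage_part_add]
      by (intro lookup_mult_closed[where P = "admissible_component n"]
          admissible_component_add admissible_component_mult)
         (auto simp: admissible_component_def)
    ultimately show ?case
      unfolding graded_set_def by (auto intro!: exI[of _ "p * q"])
  qed
qed

text \<open>Every generator is a monomial of stage \<open>Suc n\<close> times a coefficient from
  \<open>R_set n\<close>, so only the generators need checking.\<close>

lemma R_set_Suc_graded: "R_set (Suc n) \<subseteq> graded_set n"
proof -
  have one: "1 \<in> R_set n"
    using R_set_closed(3) .
  \<comment> \<open>The exponent of \<open>x\<close> separates \<open>xz_mono\<close> from the
    degrees of all other generators.\<close>
  have xz: "m \<noteq> xz_mono (Suc n) j" if "Poly_Mapping.lookup m (VX (Suc n)) = 0" for m j
    using that lookup_xz_mono[of "Suc n" j "VX (Suc n)"] by auto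
  have "monomial 0 * a \<in> graded_set n" if "a \<in> R_set n" for a
    using that xz[of 0] by (intro monomial_coeff_in_graded_set) (auto simp: admissible_coeff_def)
  then have R: "R_set n \<subseteq> graded_set n"
    by auto
  have "monomial (Poly_Mapping.single (VZ (Suc n) j) 1) * 1 \<in> graded_set n" for j
    using one xz[of "Poly_Mapping.single (VZ (Suc n) j) 1"]
    by (intro monomial_coeff_in_graded_set)
       (auto simp: admissible_coeff_def admissible_generators lookup_single when_def)
  then have Z: "z_ind (Suc n) \<gamma> \<in> graded_set n" for \<gamma>
    by (simp add: z_ind_monomial)
  have "monomial (Poly_Mapping.single (VY (Suc n)) q) * 1 \<in> graded_set n" if "q > 0" for q
    using one xz[of "Poly_Mapping.single (VY (Suc n)) q"] that
    by (intro monomial_coeff_in_graded_set)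
       (auto simp: admissible_coeff_def admissible_generators lookup_single when_def)
  then have Y: "Y_set (Suc n) \<subseteq> graded_set n"
    by (auto simp: Y_set_def ipow_monomial)
  \<comment> \<open>The coefficient is \<open>\<gamma>\<close> itself, with cofactor 1; injectivity
    of \<open>xz_mono\<close> leaves no other \<open>\<gamma>\<close> to consider.\<close>
  have X: "x_ind (Suc n) * \<gamma> / z_ind (Suc n) \<gamma> \<in> graded_set n" if "\<gamma> \<in> R_set n" for \<gamma>
    unfolding xz_mono_eq using that one
    by (intro monomial_coeff_in_graded_set)
       (auto simp: admissible_coeff_def admissible_generators xz_mono_inj
          intro!: bexI[of _ 1], simp add: xz_mono_def stage_part_diff)
  show ?thesis
    unfolding R_set.simps
    by (intro graded_set_adjoin R Y) (use X Z in \<open>auto simp: nonatomics_def\<close>)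
qed

text \<open>Since \<open>components\<close> is multiplicative, the components of \<open>a\<close>
  and \<open>b\<close> multiply to a single term, so each consists of one term. Comparing degrees
  and cancelling monomials splits \<open>m\<close> and \<open>c\<close>.\<close>

lemma factors_of_monomial:
  assumes a: "a \<in> R_set (Suc n)" and b: "b \<in> R_set (Suc n)" and ab: "a * b = monomial m * c"
    and c: "c \<in> R_set n" "c \<noteq> 0" and m: "stage_part (Suc n) m = m"
  obtains i j d e where "a = monomial i * d" "b = monomial j * e" "m = i + j" "c = d * e"
    "admissible_coeff n i d" "admissible_coeff n j e"
proof -
  let ?C = "components (stage_part (Suc n))"
  have "a \<in> graded_set n" "b \<in> graded_set n"
    using a b R_set_Suc_graded[of n] by blast+
  then obtain p q where pq: "a = Fract p 1" "b = Fract q 1"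
    "\<And>m. admissible_component n m (Poly_Mapping.lookup (?C p) m)"
    "\<And>m. admissible_component n m (Poly_Mapping.lookup (?C q) m)"
    unfolding graded_set_def by blast
  obtain r where r: "c = Fract r 1" "poly_stage_le n r"
    using c R_set_stage[of n] by (auto simp: stage_le_def)
  have "Fract (p * q) 1 = Fract (Poly_Mapping.single m 1 * r) 1"
    using ab by (simp add: pq r monomial_def)
  then have prod: "p * q = Poly_Mapping.single m 1 * r"
    by (simp add: eq_fract)
  have "monomial m * c \<noteq> 0"
    using c by simp
  then have "a \<noteq> 0" "b \<noteq> 0"
    using ab by auto
  then have ne: "p \<noteq> 0" "q \<noteq> 0"
    by (auto simp: pq simp flip: Zero_fract_def)
  have "?C p * ?C q = Poly_Mapping.single m (p * q)"
    using components_monomial_stage_le[OF r(2) m]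
    by (simp add: prod flip: components_mult[of "stage_part (Suc n)", OF stage_part_add])
  then obtain i j g h where "?C p = Poly_Mapping.single i g" "?C q = Poly_Mapping.single j h"
    using ne by (metis mult_eq_single_imp_single no_zero_divisors)
  then have C: "?C p = Poly_Mapping.single i p" "?C q = Poly_Mapping.single j q"
    using components_eq_single_imp by metis+
  obtain d where d: "admissible_coeff n i d" "a = monomial i * d"
    using pq(3)[of i] ne by (auto simp: C admissible_component_def pq(1))
  obtain e where e: "admissible_coeff n j e" "b = monomial j * e"
    using pq(4)[of j] ne by (auto simp: C admissible_component_def pq(2))
  have "Poly_Mapping.single (i + j) (p * q) = Poly_Mapping.single m (p * q)"
    using \<open>?C p * ?C q = _\<close> by (simp add: C mult_single)
  then have "Poly_Mapping.lookup (Poly_Mapping.single m (p * q)) (i + j) = p * q"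
    by (metis lookup_single_eq)
  then have ij: "m = i + j"
    using ne by (auto simp: lookup_single when_def split: if_splits)
  have "monomial m * c = (monomial i * d) * (monomial j * e)"
    by (simp only: ab[symmetric] d(2)[symmetric] e(2)[symmetric])
  also have "\<dots> = monomial m * (d * e)"
    by (simp only: ij monomial_add ac_simps)
  finally have "c = d * e"
    by simp
  then show thesis
    using that d e ij by blast
qed


section \<open>Factorization along the tower\<close>

lemma subring_on_simps [simp]:
  "carrier (subring_on A) = A"
  "x \<otimes>\<^bsub>subring_on A\<^esub> y = x * y"
  "\<one>\<^bsub>subring_on A\<^esub> = 1"
  "\<zero>\<^bsub>subring_on A\<^esub> = 0"
  by (simp_all add: subring_on_def ring_of_type_algebra_def)

lemma D_ring_simps [simp]:
  "carrier D_ring = D_set"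
  "x \<otimes>\<^bsub>D_ring\<^esub> y = x * y"
  "\<one>\<^bsub>D_ring\<^esub> = 1"
  "\<zero>\<^bsub>D_ring\<^esub> = 0"
  by (simp_all add: D_ring_def)

lemma Units_subring_on: "a \<in> Units (subring_on A) \<longleftrightarrow> a \<in> A \<and> (\<exists>b\<in>A. a * b = 1)"
  by (auto simp: Units_def mult.commute)

lemma irreducibles_subring_on:
  assumes "subring A ring_of_type_algebra"
  shows "p \<in> irreducibles (subring_on A) \<longleftrightarrow> p \<in> A \<and> p \<noteq> 0 \<and> p \<notin> Units (subring_on A) \<and>
    (\<forall>a\<in>A. \<forall>b\<in>A. p = a * b \<longrightarrow> a \<in> Units (subring_on A) \<or> b \<in> Units (subring_on A))"
proof -
  interpret domain "subring_on A"
    by (rule subring_on_domain[OF assms])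
  show ?thesis
    unfolding irreducibles_def
    using ring_irreducibleE[of p] ring_irreducibleI[of p] by auto
qed

section \<open>Divisors, units and irreducibles persist in \<open>D_set\<close>\<close>

text \<open>The product has degree 0, and admissible degrees add up to 0 only trivially.\<close>

lemma R_set_divisor_closed_Suc:
  assumes "a \<in> R_set (Suc n)" "b \<in> R_set (Suc n)" "a * b \<in> R_set n" "a * b \<noteq> 0"
  shows "a \<in> R_set n"
proof -
  have "a * b = monomial 0 * (a * b)"
    by simp
  from factors_of_monomial[OF assms(1,2) this assms(3,4) stage_part_0] obtain i j d e
    where f: "a = monomial i * d" "0 = i + j" "admissible_coeff n i d" "admissible_coeff n j e"
    by metis
  then have "i = 0"
    by (metis admissible_coeff_def admissible_sum_0(1))
  then show ?thesis
    using f by (simp add: admissible_coeff_def)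
qed

text \<open>The product lies in every ring between \<open>R_set n\<close> and
  \<open>R_set k\<close>, so both factors descend one stage at a time.\<close>

lemma R_set_divisor_closed:
  assumes "n \<le> k" "a \<in> R_set k" "b \<in> R_set k" "a * b \<in> R_set n" "a * b \<noteq> 0"
  shows "a \<in> R_set n"
  using assms
proof (induction k rule: dec_induct)
  case (step k)
  have ab: "a * b \<in> R_set k"
    using step.hyps step.prems(3) R_set_mono by blast
  have "a \<in> R_set k" "b \<in> R_set k"
    using R_set_divisor_closed_Suc[of a k b] R_set_divisor_closed_Suc[of b k a] ab step.prems
    by (simp_all add: mult.commute)
  then show ?case
    using step.IH step.prems by blast
qed

lemma D_set_common:
  assumes "a \<in> D_set" "b \<in> D_set"
  obtains k where "n \<le> k" "a \<in> R_set k" "b \<in> R_set k"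
proof -
  obtain i j where "a \<in> R_set i" "b \<in> R_set j"
    using assms by (auto simp: D_set_def)
  moreover have "R_set i \<subseteq> R_set (max n (max i j))" "R_set j \<subseteq> R_set (max n (max i j))"
    by (simp_all add: R_set_mono)
  ultimately show thesis
    using that[of "max n (max i j)"] by auto
qed

lemma D_set_divisor_closed:
  assumes "a \<in> D_set" "b \<in> D_set" "a * b \<in> R_set n" "a * b \<noteq> 0"
  shows "a \<in> R_set n" "b \<in> R_set n"
proof -
  obtain k where "n \<le> k" "a \<in> R_set k" "b \<in> R_set k"
    using D_set_common assms(1,2) .
  then show "a \<in> R_set n" "b \<in> R_set n"
    using R_set_divisor_closed[of n k a b] R_set_divisor_closed[of n k b a] assms(3,4)
    by (simp_all add: mult.commute)
qed

lemma R_set_subset_D_set: "R_set n \<subseteq> D_set"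
  by (auto simp: D_set_def)

text \<open>An inverse is a divisor of 1, and 1 lies in \<open>R_set n\<close>.\<close>

lemma Units_D_ring:
  assumes "a \<in> R_set n"
  shows "a \<in> Units D_ring \<longleftrightarrow> a \<in> Units (R_ring n)"
proof
  assume "a \<in> Units D_ring"
  then obtain b where "a \<in> D_set" "b \<in> D_set" "a * b = 1"
    by (auto simp: D_ring_def Units_subring_on)
  then show "a \<in> Units (R_ring n)"
    using D_set_divisor_closed(2)[of a b n] R_set_closed(3)[of n] assms
    by (auto simp: R_ring_def Units_subring_on)
next
  assume "a \<in> Units (R_ring n)"
  then show "a \<in> Units D_ring"
    using R_set_subset_D_set by (auto simp: D_ring_def R_ring_def Units_subring_on)
qed

text \<open>A factorization in \<open>D_set\<close> of a nonzero element of \<open>R_set n\<close>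
  already takes place in \<open>R_set n\<close>.\<close>

lemma irreducibles_R_ring_subset: "irreducibles (R_ring n) \<subseteq> irreducibles D_ring"
proof
  fix p assume "p \<in> irreducibles (R_ring n)"
  then have p: "p \<in> R_set n" "p \<noteq> 0" "p \<notin> Units (R_ring n)"
    "\<And>a b. a \<in> R_set n \<Longrightarrow> b \<in> R_set n \<Longrightarrow> p = a * b \<Longrightarrow> a \<in> Units (R_ring n) \<or> b \<in> Units (R_ring n)"
    unfolding R_ring_def irreducibles_subring_on[OF R_set_subring] by blast+
  have "a \<in> Units D_ring \<or> b \<in> Units D_ring" if "a \<in> D_set" "b \<in> D_set" "p = a * b" for a b
  proof -
    have "a \<in> R_set n" "b \<in> R_set n"
      using D_set_divisor_closed[of a b n] that p(1,2) by simp_all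
    then show ?thesis
      using p(4)[OF _ _ that(3)] by (simp add: Units_D_ring)
  qed
  then show "p \<in> irreducibles D_ring"
    using p(1-3) R_set_subset_D_set[of n] Units_D_ring[of p n]
    unfolding D_ring_def irreducibles_subring_on[OF D_set_subring] by blast
qed

lemma Units_R_ringI:
  assumes "c \<in> R_set n" "d \<in> R_set n" "c * d = 1" "n \<le> k"
  shows "c \<in> Units (R_ring k)"
  using assms R_set_mono[of n k] by (auto simp: R_ring_def Units_subring_on)

lemma unit_of_R_Suc:
  assumes "a \<in> Units (R_ring (Suc n))"
  shows "a \<in> R_set n"
proof -
  obtain b where "a \<in> R_set (Suc n)" "b \<in> R_set (Suc n)" "a * b = 1"
    using assms by (auto simp: R_ring_def Units_subring_on)
  then show ?thesis
    using R_set_divisor_closed_Suc[of a n b] R_set_closed(3)[of n] by simp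
qed

section \<open>Irreducibility of the new generators\<close>

text \<open>Such an element would be homogeneous both of degree 0 and of degree
  \<open>m\<close>.\<close>

lemma monomial_times_notin_R_set:
  assumes m: "stage_part (Suc n) m = m" "m \<noteq> 0" and c: "c \<in> R_set n" "c \<noteq> 0"
  shows "monomial m * c \<notin> R_set n"
proof
  assume "monomial m * c \<in> R_set n"
  then have "monomial m * c \<in> stage_le n" "c \<in> stage_le n"
    using c R_set_stage[of n] by blast+
  then obtain p q where pq: "monomial m * c = Fract p 1" "poly_stage_le n p"
    "c = Fract q 1" "poly_stage_le n q"
    unfolding stage_le_def by blast
  then have "p = Poly_Mapping.single m 1 * q"
    by (simp add: monomial_def eq_fract)
  then have "Poly_Mapping.single 0 p = Poly_Mapping.single m p"
    using components_monomial_stage_le[OF pq(2), of 0] components_monomial_stage_le[OF pq(4) m(1)]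
    by simp
  then have "Poly_Mapping.lookup (Poly_Mapping.single m p) 0 = p"
    by (metis lookup_single_eq)
  then have "p = 0"
    using m(2) by (auto simp: lookup_single when_def)
  then have "monomial m * c = 0"
    using pq(1) by (simp add: Zero_fract_def)
  then show False
    using c by simp
qed

text \<open>The degree \<open>m\<close> is indecomposable, so one factor has degree 0 and the other
  carries \<open>m\<close>. The hypothesis \<open>unit\<close> turns the former into a unit; this is
  where the arithmetic of \<open>c\<close> enters.\<close>

lemma monomial_irreducible:
  assumes R: "monomial m * c \<in> R_set (Suc n)" and c: "c \<in> R_set n" "c \<noteq> 0"
    and m: "stage_part (Suc n) m = m" "weight m = 1" "Poly_Mapping.lookup m (VY (Suc n)) = 0"
    and unit: "\<And>d e. d \<in> R_set n \<Longrightarrow> c = d * e \<Longrightarrow> admissible_coeff n m e \<Longrightarrow> \<exists>t\<in>R_set n. d * t = 1"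
  shows "monomial m * c \<in> irreducibles (R_ring (Suc n))"
proof -
  let ?U = "Units (R_ring (Suc n))"
  have "m \<noteq> 0"
    using m(2) by auto
  then have "monomial m * c \<notin> ?U"
    using unit_of_R_Suc monomial_times_notin_R_set m(1) c by blast
  moreover have "a \<in> ?U \<or> b \<in> ?U"
    if a: "a \<in> R_set (Suc n)" and b: "b \<in> R_set (Suc n)" and ab: "monomial m * c = a * b" for a b
  proof -
    obtain i j d e where f: "a = monomial i * d" "b = monomial j * e" "m = i + j" "c = d * e"
      "admissible_coeff n i d" "admissible_coeff n j e"
      by (rule factors_of_monomial[OF a b ab[symmetric] c m(1)])
    then have "i = 0 \<or> j = 0"
      using m by (intro admissible_sum_weight_1[of "Suc n"]) (auto simp: admissible_coeff_def)
    then show ?thesis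
    proof
      assume "i = 0"
      then obtain t where "t \<in> R_set n" "d * t = 1"
        using unit[of d e] f by (auto simp: admissible_coeff_def)
      then show ?thesis
        using Units_R_ringI[of d n t "Suc n"] f \<open>i = 0\<close> by (simp add: admissible_coeff_def)
    next
      assume "j = 0"
      then obtain t where "t \<in> R_set n" "e * t = 1"
        using unit[of e d] f by (auto simp: admissible_coeff_def mult.commute)
      then show ?thesis
        using Units_R_ringI[of e n t "Suc n"] f \<open>j = 0\<close> by (simp add: admissible_coeff_def)
    qed
  qed
  ultimately show ?thesis
    using R c by (auto simp: R_ring_def irreducibles_subring_on[OF R_set_subring])
qed

lemma generators_in_R_set_Suc:
  assumes "\<gamma> \<in> nonatomics (R_set n)"
  shows "z_ind (Suc n) \<gamma> \<in> R_set (Suc n)" "x_ind (Suc n) * \<gamma> / z_ind (Suc n) \<gamma> \<in> R_set (Suc n)"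
proof -
  have "{z_ind (Suc n) \<gamma> | \<gamma>. \<gamma> \<in> nonatomics (R_set n)} \<subseteq> R_set (Suc n)"
    unfolding R_set.simps by (meson adjoin_incl order_trans)
  moreover have
    "{x_ind (Suc n) * \<gamma> / z_ind (Suc n) \<gamma> | \<gamma>. \<gamma> \<in> nonatomics (R_set n)} \<subseteq> R_set (Suc n)"
    unfolding R_set.simps by (rule order_trans[OF adjoin_incl(2)], rule adjoin_incl(1))
  ultimately show "z_ind (Suc n) \<gamma> \<in> R_set (Suc n)"
    "x_ind (Suc n) * \<gamma> / z_ind (Suc n) \<gamma> \<in> R_set (Suc n)"
    using assms by blast+
qed

lemma Y_set_subset: "Y_set (Suc n) \<subseteq> R_set (Suc n)"
  unfolding R_set.simps by (rule adjoin_incl(2))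

text \<open>The coefficient is 1, so the cofactor \<open>e\<close> is an inverse of
  \<open>d\<close>.\<close>

lemma z_ind_irreducible:
  assumes "\<gamma> \<in> nonatomics (R_set n)"
  shows "z_ind (Suc n) \<gamma> \<in> irreducibles (R_ring (Suc n))"
proof -
  let ?m = "Poly_Mapping.single (VZ (Suc n) (to_nat \<gamma>)) 1"
  have "monomial ?m * 1 \<in> irreducibles (R_ring (Suc n))"
    using generators_in_R_set_Suc(1)[OF assms] R_set_closed(3)[of n]
    by (intro monomial_irreducible)
       (auto simp: z_ind_monomial lookup_single when_def admissible_coeff_def)
  then show ?thesis
    by (simp add: z_ind_monomial)
qed

text \<open>The cofactor of degree \<open>xz_mono\<close> is \<open>\<gamma> t\<close>, so
  \<open>\<gamma> = d \<gamma> t\<close>, and cancelling \<open>\<gamma>\<close> makes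
  \<open>d\<close> a unit.\<close>

lemma x_ind_div_z_ind_irreducible:
  assumes "\<gamma> \<in> nonatomics (R_set n)" "\<gamma> \<noteq> 0"
  shows "x_ind (Suc n) * \<gamma> / z_ind (Suc n) \<gamma> \<in> irreducibles (R_ring (Suc n))"
  unfolding xz_mono_eq
proof (rule monomial_irreducible)
  fix d e assume de: "d \<in> R_set n" "\<gamma> = d * e" "admissible_coeff n (xz_mono (Suc n) (to_nat \<gamma>)) e"
  then obtain t where t: "t \<in> R_set n" "e = \<gamma> * t"
    by (auto simp: admissible_coeff_def)
  then have "\<gamma> * (d * t) = \<gamma> * 1"
    using de(2) by (simp add: ac_simps)
  then have "d * t = 1"
    using assms(2) by (simp only: mult_cancel_left) simp
  with t show "\<exists>t\<in>R_set n. d * t = 1"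
    by blast
qed (use assms generators_in_R_set_Suc(2)[OF assms(1)] in
     \<open>auto simp: xz_mono_eq nonatomics_def lookup_xz_mono stage_part_diff\<close>,
     simp add: xz_mono_def stage_part_diff)

text \<open>An irreducible factor of 1 would be a unit. This provides \<open>z\<^sub>1\<close> and
  \<open>x / z\<^sub>1\<close> at every stage.\<close>

lemma one_nonatomic: "1 \<in> nonatomics (R_set n)"
proof -
  have closed: "list_prod (subring_on (R_set n)) ps \<in> R_set n" if "set ps \<subseteq> R_set n" for ps
    using that by (induction ps) (auto simp: list_prod_def R_set_closed(3,6))
  have "\<not> atomic (subring_on (R_set n)) 1"
  proof
    assume "atomic (subring_on (R_set n)) 1"
    then obtain ps where ps: "ps \<noteq> []" "set ps \<subseteq> irreducibles (subring_on (R_set n))"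
      "1 = list_prod (subring_on (R_set n)) ps"
      by (auto simp: atomic_def)
    obtain p qs where eq: "ps = p # qs"
      using ps(1) by (cases ps) auto
    have irr: "set ps \<subseteq> R_set n"
      using ps(2) by (auto simp: irreducibles_def)
    have "p * list_prod (subring_on (R_set n)) qs = 1"
      using ps(3) by (simp add: eq list_prod_def)
    then have "p \<in> Units (subring_on (R_set n))"
      using irr closed[of qs] by (auto simp: eq Units_subring_on)
    then show False
      using ps(2) by (simp add: eq irreducibles_subring_on[OF R_set_subring])
  qed
  then show ?thesis
    by (simp add: nonatomics_def R_set_closed(3))
qed

section \<open>Almost atomicity\<close>

lemma list_prod_R_ring: "list_prod (R_ring n) ps = list_prod D_ring ps"
  by (simp add: list_prod_def R_ring_def D_ring_def subring_on_def)

lemma list_prod_D_ring [simp]: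
  "list_prod D_ring [] = 1" "list_prod D_ring (p # ps) = p * list_prod D_ring ps"
  by (simp_all add: list_prod_def)

theorem D_ring_almost_atomic: "almost_atomic D_ring"
  unfolding almost_atomic_def
proof
  fix a assume "a \<in> nonzero_nonunits D_ring"
  then have "a \<in> D_set" and a0: "a \<noteq> 0"
    by (auto simp: nonzero_nonunits_def)
  then obtain n where an: "a \<in> R_set n"
    by (auto simp: D_set_def)
  show "\<exists>ps. ps \<noteq> [] \<and> set ps \<subseteq> irreducibles D_ring \<and>
      atomic D_ring (a \<otimes>\<^bsub>D_ring\<^esub> list_prod D_ring ps)"
  \<comment> \<open>Atomicity is tested in \<open>R_ring n\<close>, because the next stage adjoins
    generators for exactly the nonatomic elements of that ring.\<close>
  proof (cases "atomic (R_ring n) a")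
    case True
    then obtain ps where ps: "ps \<noteq> []" "set ps \<subseteq> irreducibles D_ring" "a = list_prod D_ring ps"
      using irreducibles_R_ring_subset[of n] by (auto simp: atomic_def list_prod_R_ring)
    \<comment> \<open>The list of multipliers must be nonempty, so an atomic \<open>a\<close> is
      multiplied by a repeated factor of its own.\<close>
    let ?p = "hd ps"
    have "atomic D_ring (a * ?p)"
      unfolding atomic_def
      by (rule exI[of _ "?p # ps"]) (use ps in \<open>auto simp: mult.commute\<close>)
    then show ?thesis
      using ps by (intro exI[of _ "[?p]"]) auto
  next
    case False
    then have \<gamma>: "a \<in> nonatomics (R_set n)"
      using an by (simp add: nonatomics_def R_ring_def)
    let ?z = "z_ind (Suc n)" and ?x = "x_ind (Suc n)"
    \<comment> \<open>The product of \<open>?ps\<close> is \<open>x\<close>, and that of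
      \<open>?qs\<close> is \<open>x a\<close>.\<close>
    let ?ps = "[?z 1, ?x * 1 / ?z 1]" and ?qs = "[?z a, ?x * a / ?z a]"
    have irr: "set ?ps \<subseteq> irreducibles D_ring" "set ?qs \<subseteq> irreducibles D_ring"
      using z_ind_irreducible[OF \<gamma>] z_ind_irreducible[OF one_nonatomic[of n]]
        x_ind_div_z_ind_irreducible[OF \<gamma> a0] x_ind_div_z_ind_irreducible[OF one_nonatomic[of n]]
        irreducibles_R_ring_subset[of "Suc n"] by auto
    have "?z \<gamma> \<noteq> 0" for \<gamma>
      by (simp add: z_ind_monomial)
    then have "a * list_prod D_ring ?ps = list_prod D_ring ?qs"
      by simp
    then have "atomic D_ring (a * list_prod D_ring ?ps)"
      unfolding atomic_def using irr(2) by (intro exI[of _ ?qs]) simp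
    then show ?thesis
      using irr(1) by (intro exI[of _ ?ps]) simp
  qed
qed

section \<open>Failure of the semi-Furstenberg property\<close>

text \<open>Units of \<open>R_ring (Suc n)\<close> lie in \<open>R_set n\<close>, which contains no
  monomial of nonzero degree.\<close>

lemma Y_nonunit:
  assumes "q > 0"
  shows "ipow (VY (Suc n)) q \<in> D_set" "ipow (VY (Suc n)) q \<notin> Units D_ring"
proof -
  have Y: "ipow (VY (Suc n)) q \<in> R_set (Suc n)"
    using assms Y_set_subset[of n] by (auto simp: Y_set_def)
  then show "ipow (VY (Suc n)) q \<in> D_set"
    using R_set_subset_D_set by blast
  let ?m = "Poly_Mapping.single (VY (Suc n)) q"
  have "Poly_Mapping.lookup ?m (VY (Suc n)) \<noteq> 0"
    using assms by simp
  then have "?m \<noteq> 0"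
    by (metis lookup_zero)
  then have "monomial ?m * 1 \<notin> R_set n"
    using R_set_closed(3)[of n] by (intro monomial_times_notin_R_set) auto
  then show "ipow (VY (Suc n)) q \<notin> Units D_ring"
    using unit_of_R_Suc[of _ n] Units_D_ring[OF Y] by (auto simp: ipow_monomial)
qed

theorem D_ring_not_semi_Furstenberg: "\<not> semi_Furstenberg D_ring"
proof
  assume "semi_Furstenberg D_ring"
  then obtain b where b: "b \<in> D_set" and
    F: "\<And>a. a \<in> nonzero_nonunits D_ring \<Longrightarrow>
      \<exists>p\<in>irreducibles D_ring. p divides\<^bsub>D_ring\<^esub> (a * b) \<and> \<not> p divides\<^bsub>D_ring\<^esub> b"
    by (auto simp: semi_Furstenberg_def)
  obtain n where n: "b \<in> R_set n"
    using b by (auto simp: D_set_def)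
  define y where "y = ipow (VY (Suc n))"
  have y: "y q \<in> D_set" "y q \<notin> Units D_ring" if "q > 0" for q
    using Y_nonunit[OF that] by (simp_all add: y_def)
  have y_add: "y (q + r) = y q * y r" for q r
    by (simp add: y_def ipow_monomial single_add monomial_add)
  have "y 1 \<in> nonzero_nonunits D_ring"
    using y[of 1] by (simp add: nonzero_nonunits_def y_def ipow_monomial)
  then obtain p where p: "p \<in> irreducibles D_ring" "p divides\<^bsub>D_ring\<^esub> (y 1 * b)"
    and nb: "\<not> p divides\<^bsub>D_ring\<^esub> b"
    using F by blast
  note p_irr = p(1)[unfolded D_ring_def irreducibles_subring_on[OF D_set_subring], folded D_ring_def]
  obtain t where t: "t \<in> D_set" "y 1 * b = p * t"
    using p(2) by (auto simp: factor_def)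
  \<comment> \<open>Every element divides 0, so \<open>nb\<close> rules out this case.\<close>
  have "b \<noteq> 0"
    using nb p_irr subringE(2)[OF D_set_subring] by (auto simp: factor_def)
  then have ne: "p * t \<noteq> 0"
    using t(2) by (metis monomial_nonzero no_zero_divisors ipow_monomial y_def)
  \<comment> \<open>This brings \<open>p\<close> and \<open>t\<close> down to stage
    \<open>Suc n\<close>, where the grading applies.\<close>
  have "p * t \<in> R_set (Suc n)"
    using Y_set_subset[of n] R_set_Suc[of n] n t(2)
    by (metis (mono_tags, lifting) R_set_closed(6) Y_set_def mem_Collect_eq subsetD y_def zero_less_one)
  then have pt: "p \<in> R_set (Suc n)" "t \<in> R_set (Suc n)"
    using D_set_divisor_closed[of p t "Suc n"] p_irr t(1) ne by auto
  have eq: "p * t = monomial (Poly_Mapping.single (VY (Suc n)) 1) * b"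
    using t(2) by (simp add: y_def ipow_monomial)
  obtain i j d e where f: "p = monomial i * d" "t = monomial j * e"
    "Poly_Mapping.single (VY (Suc n)) 1 = i + j" "b = d * e"
    "admissible_coeff n i d" "admissible_coeff n j e"
    by (rule factors_of_monomial[OF pt eq n \<open>b \<noteq> 0\<close>]) auto
  have adm: "admissible (Suc n) i" "admissible (Suc n) j"
    using f(5,6) by (simp_all add: admissible_coeff_def)
  \<comment> \<open>Since \<open>y\<close> has weight 0, the degree of \<open>p\<close> has weight 0
    too, so it is a power of \<open>y\<close>.\<close>
  have "weight (i + j) = 0"
    by (simp flip: f(3))
  from admissible_sum_weight_0[OF adm this] adm
  obtain q where q: "q \<ge> 0" "i = Poly_Mapping.single (VY (Suc n)) q"
    by (auto elim: admissible_weight_0)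
  have dD: "d \<in> D_set" "e \<in> D_set"
    using f R_set_subset_D_set by (auto simp: admissible_coeff_def)
  have "q = 0"
  proof (rule ccontr)
    assume "q \<noteq> 0"
    then have "q / 2 > 0"
      using q(1) by simp
    note half = y[OF this]
    \<comment> \<open>Irreducibility of \<open>p\<close> would make the second factor a unit, since
      the first is not; but the second factor is a multiple of the same nonunit.\<close>
    have split: "p = y (q / 2) * (y (q / 2) * d)"
      unfolding f(1) q(2) using y_add[of "q / 2" "q / 2"] by (simp add: y_def ipow_monomial)
    have yd: "y (q / 2) * d \<in> D_set"
      using subringE(6)[OF D_set_subring] half(1) dD(1) by simp
    then have "y (q / 2) * d \<in> Units D_ring"
      using p_irr split half by blast
    then obtain s where "s \<in> D_set" "y (q / 2) * d * s = 1"
      by (auto simp: D_ring_def Units_subring_on)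
    then have "y (q / 2) \<in> Units D_ring"
      using half(1) subringE(6)[OF D_set_subring, of d s] dD(1)
      by (auto simp: D_ring_def Units_subring_on mult.assoc)
    then show False
      using half(2) by blast
  qed
  then have "p = d"
    using f(1) q(2) by simp
  then have "p divides\<^bsub>D_ring\<^esub> b"
    using f(4) dD by (auto simp: factor_def)
  then show False
    using nb by blast
qed

theorem theorem24:
  shows "almost_atomic D_ring \<and> \<not> semi_Furstenberg D_ring"
  using D_ring_almost_atomic D_ring_not_semi_Furstenberg by blast

end
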